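(* Let $G$ be a finite simple graph. Then $G$ is square-stable, i.e. $\alpha(G)=\alpha(G^2)$, if and only if $\Omega(G^2)\subseteq\Omega(G)$.
   Context: $G^2$ is the graph on $V(G)$ in which distinct vertices $v,w$ are adjacent iff $\mathrm{dist}_G(v,w)\le 2$. $\alpha(G)$ is the maximum cardinality of a stable (independent) set, and $\Omega(G)$ is the set of all maximum (cardinality) stable sets of $G$. *)

theory Defs
  imports "Graph_Theory.Graph_Theory"
begin

text \<open>
  A finite simple graph is a \<open>pair_graph\<close>: a finite, loop-free, symmetric set of arcs on a
  finite vertex set, so that the edge joining \<open>v\<close> and \<open>w\<close> is the pair of arcs
  \<open>(v, w)\<close>, \<open>(w, v)\<close>. The graph without vertices is included.
\<close>

text \<open>The distance is infinite when no walk joins the two vertices.\<close>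

definition graph_dist :: "'a pair_pre_digraph \<Rightarrow> 'a \<Rightarrow> 'a \<Rightarrow> ereal" where
  "graph_dist G v w = wf_digraph.\<mu> (with_proj G) (\<lambda>_. 1) v w"

definition square :: "'a pair_pre_digraph \<Rightarrow> 'a pair_pre_digraph" where
  "square G = \<lparr> pverts = pverts G,
     parcs = {(v, w). v \<in> pverts G \<and> w \<in> pverts G \<and> v \<noteq> w \<and> graph_dist G v w \<le> 2} \<rparr>"

definition stable_set :: "'a pair_pre_digraph \<Rightarrow> 'a set \<Rightarrow> bool" where
  "stable_set G S \<longleftrightarrow> S \<subseteq> pverts G \<and> (\<forall>v\<in>S. \<forall>w\<in>S. (v, w) \<notin> parcs G)"

definition stability_number :: "'a pair_pre_digraph \<Rightarrow> nat" where
  "stability_number G = Max (card ` {S. stable_set G S})"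

definition max_stable_sets :: "'a pair_pre_digraph \<Rightarrow> 'a set set" where
  "max_stable_sets G = {S. stable_set G S \<and> card S = stability_number G}"

definition square_stable :: "'a pair_pre_digraph \<Rightarrow> bool" where
  "square_stable G \<longleftrightarrow> stability_number G = stability_number (square G)"

lemma (in pair_graph) graph_dist_commute: "graph_dist G v w = graph_dist G w v"
proof -
  have cost: "awalk_cost (\<lambda>_. 1) p = real (length p)" for p :: "('a \<times> 'a) awalk"
    by (induct p) simp_all
  have len: "length (rev_path p) = length p" for p :: "('a \<times> 'a) awalk"
    by (induct p) simp_all
  have le: "graph_dist G x y \<le> graph_dist G y x" for x y
    unfolding graph_dist_def \<mu>_def
  proof (rule INF_greatest)
    fix p assume "p \<in> {p. awalk y p x}"
    then have "awalk x (rev_path p) y" by simp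
    then show "(INF p\<in>{p. awalk x p y}. ereal (awalk_cost (\<lambda>_. 1) p)) \<le> ereal (awalk_cost (\<lambda>_. 1) p)"
      by (intro INF_lower2[of "rev_path p"]) (simp_all add: cost len)
  qed
  show ?thesis by (rule antisym) (rule le)+
qed

lemma (in pair_graph) pair_graph_square: "pair_graph (square G)"
proof
  have "parcs (square G) \<subseteq> pverts G \<times> pverts G" by (auto simp: square_def)
  then show "finite (parcs (square G))"
    by (rule finite_subset) (simp add: pair_finite_verts)
  show "symmetric (with_proj (square G))"
    by (auto simp: symmetric_def square_def graph_dist_commute intro!: symI)
qed (auto simp: square_def pair_finite_verts)

end

theory Submission
  imports Defs
begin

text \<open>
  The vertices of \<open>G\<close> and of its square agree and adjacent vertices have distance at most \<open>1\<close>,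
  so every stable set of the square is stable in \<open>G\<close>. Hence a maximum stable set of the square
  is a maximum stable set of \<open>G\<close> exactly when its cardinality, the stability number of the square,
  is that of \<open>G\<close>. This condition does not depend on the set, so it remains to know that the square
  has a maximum stable set at all; otherwise the inclusion could hold vacuously. It has one because
  the empty set is stable and there are only finitely many vertices.
\<close>

lemma (in pair_graph) graph_dist_le_one_if_arc:
  assumes "(v, w) \<in> parcs G"
  shows "graph_dist G v w \<le> 1"
proof -
  have "awalk v [(v, w)] w"
    using arc_implies_awalk[of "(v, w)"] assms by simp
  then show ?thesis
    unfolding graph_dist_def \<mu>_def
    by (intro INF_lower2[of "[(v, w)]"]) simp_all
qed

lemma (in pair_graph) parcs_subset_parcs_square: "parcs G \<subseteq> parcs (square G)"
proof (rule subrelI)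
  fix v w assume arc: "(v, w) \<in> parcs G"
  have "graph_dist G v w \<le> 2"
    using graph_dist_le_one_if_arc[OF arc] by (rule order_trans) simp
  moreover have "v \<in> pverts G" "w \<in> pverts G"
    using arc by (auto dest: in_arcsD1 in_arcsD2)
  moreover have "v \<noteq> w"
    using no_loops arc by fastforce
  ultimately show "(v, w) \<in> parcs (square G)"
    by (simp add: square_def)
qed

lemma (in pair_graph) stable_set_if_stable_set_square:
  "stable_set (square G) S \<Longrightarrow> stable_set G S"
  using parcs_subset_parcs_square by (auto simp: stable_set_def square_def)

lemma (in pair_graph) max_stable_sets_nonempty: "max_stable_sets G \<noteq> {}"
proof -
  have "finite {S. stable_set G S}"
    by (rule finite_subset[of _ "Pow (pverts G)"]) (auto simp: stable_set_def pair_finite_verts)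
  moreover have "stable_set G {}"
    by (simp add: stable_set_def)
  ultimately have "stability_number G \<in> card ` {S. stable_set G S}"
    unfolding stability_number_def by (intro Max_in) auto
  then show ?thesis
    by (auto simp: max_stable_sets_def)
qed

theorem proposition2p1:
  fixes G :: "'a pair_pre_digraph"
  assumes "pair_graph G"
  shows "square_stable G \<longleftrightarrow> max_stable_sets (square G) \<subseteq> max_stable_sets G"
proof
  interpret pair_graph G by fact
  show "max_stable_sets (square G) \<subseteq> max_stable_sets G" if "square_stable G"
    using that stable_set_if_stable_set_square
    by (auto simp: square_stable_def max_stable_sets_def)
next
  interpret pair_graph G by fact
  assume incl: "max_stable_sets (square G) \<subseteq> max_stable_sets G"
  obtain S where "S \<in> max_stable_sets (square G)"
    using pair_graph.max_stable_sets_nonempty[OF pair_graph_square] by blast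
  with incl show "square_stable G"
    by (auto simp: square_stable_def max_stable_sets_def)
qed

end
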